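(* Let $n\ge 1$. The type B odd Demazure operators $\partial_1^-,\dots,\partial_{n-1}^-,\partial_n^{B}$ on the skew-polynomial algebra $\mathrm{Pol}_n^-$, together with the operators of left multiplication by $x_1,\dots,x_n$, define a representation of the spin type B nilHecke algebra ${}^{B}\mathrm{NH}_n^-$ on $\mathrm{Pol}_n^-$ (the generators $x_i$, $\partial_i^-$, $\partial_n^B$ acting by the operators of the same name).
   Context: $\mathrm{Pol}_n^-$ is the unital $\mathbb{Z}$-algebra generated by $x_1,\dots,x_n$ subject to $x_ix_j+x_jx_i=0$ for all $i\ne j$. The spin type B nilHecke algebra ${}^{B}\mathrm{NH}_n^-$ is the unital $\mathbb{Z}$-algebra generated by $x_1,\dots,x_n$, $\partial_1^-,\dots,\partial_{n-1}^-$, $\partial_n^B$ subject to $x_ix_j+x_jx_i=0$ ($i\neq j$) and, for $1\le i\le n-1$ (whenever the indices make sense): $(\partial_i^-)^2=0$; $\partial_i^-\partial_{i+1}^-\partial_i^-=\partial_{i+1}^-\partial_i^-\partial_{i+1}^-$; $\partial_i^-\partial_j^-+\partial_j^-\partial_i^-=0$ for $|i-j|>1$; $x_i\partial_i^-+\partial_i^-x_{i+1}=1$; $\partial_i^-x_i+x_{i+1}\partial_i^-=1$; $\partial_i^-x_j+x_j\partial_i^-=0$ for $j\ne i,i+1$; and $(\partial_n^B)^2=0$; $\partial_n^B\partial_{n-1}^-\partial_n^B\partial_{n-1}^-=-\partial_{n-1}^-\partial_n^B\partial_{n-1}^-\partial_n^B$; $\partial_n^B\partial_i^-+\partial_i^-\partial_n^B=0$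 for $1\le i\le n-2$; $\partial_n^Bx_n+x_n\partial_n^B=1$; $\partial_n^Bx_i+x_i\partial_n^B=0$ for $1\le i\le n-1$. Odd Demazure operators. For $1\le i\le n-1$ let $s_i$ be the algebra endomorphism of $\mathrm{Pol}_n^-$ with $s_i(x_i)=-x_{i+1}$, $s_i(x_{i+1})=-x_i$, $s_i(x_j)=-x_j$ for $j\ne i,i+1$, and let $s_n^B$ be the algebra endomorphism with $s_n^B(x_j)=-x_j$ for all $j$. The type B odd Demazure operators are the $\mathbb{Z}$-linear operators $\partial_i^-$ ($1\le i\le n-1$) and $\partial_n^B$ on $\mathrm{Pol}_n^-$ that kill $1$ and satisfy: $\partial_i^-(x_j)=1$ if $j\in\{i,i+1\}$ and $0$ otherwise; $\partial_n^B(x_j)=1$ if $j=n$ and $0$ otherwise; and, for all $f,g\in\mathrm{Pol}_n^-$, $\partial_i^-(fg)=\partial_i^-(f)g+s_i(f)\partial_i^-(g)$ and $\partial_n^B(fg)=\partial_n^B(f)g+s_n^B(f)\partial_n^B(g)$. *)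

theory Defs
  imports "HOL-Algebra.QuotRing" "HOL-Library.Poly_Mapping" "HOL-Library.FuncSet"
begin

section \<open>Unital rings given by generators and relations\<close>

text \<open>A unital \<open>\<int>\<close>-algebra is the same thing as a ring with unit, and an algebra homomorphism
  is a unital ring homomorphism; both are expressed by \<^const>\<open>ring\<close> and \<^const>\<open>ring_hom\<close>.\<close>

datatype 'a fmon = Word (letters: "'a list")

instantiation fmon :: (type) monoid_add
begin
definition zero_fmon :: "'a fmon" where
  "0 = Word []"
definition plus_fmon :: "'a fmon \<Rightarrow> 'a fmon \<Rightarrow> 'a fmon" where
  "u + v = Word (letters u @ letters v)"
instance by standard (auto simp: zero_fmon_def plus_fmon_def)
end

text \<open>The monoid operation on words is written additively only because the convolution product
  on \<^typ>\<open>'a fmon \<Rightarrow>\<^sub>0 int\<close> (which is then the product of noncommutative polynomials) is set up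
  for additive exponents.\<close>

definition free_alg :: "'a set \<Rightarrow> ('a fmon \<Rightarrow>\<^sub>0 int) ring" where
  "free_alg S =
     \<lparr>carrier = {p. \<forall>w\<in>Poly_Mapping.keys p. set (letters w) \<subseteq> S},
      mult = (*), one = 1, zero = 0, add = (+)\<rparr>"

definition gen :: "'a \<Rightarrow> ('a fmon \<Rightarrow>\<^sub>0 int)" where
  "gen a = Poly_Mapping.single (Word [a]) 1"

text \<open>\<open>presented S R\<close> is the ring generated by \<open>S\<close> subject to \<open>r = 0\<close> for all \<open>r \<in> R\<close>;
  \<^const>\<open>genideal\<close> is the two-sided ideal generated by a set.\<close>

definition presented :: "'a set \<Rightarrow> ('a fmon \<Rightarrow>\<^sub>0 int) set \<Rightarrow> ('a fmon \<Rightarrow>\<^sub>0 int) set ring" where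
  "presented S R = free_alg S Quot (genideal (free_alg S) R)"

definition presented_gen ::
    "'a set \<Rightarrow> ('a fmon \<Rightarrow>\<^sub>0 int) set \<Rightarrow> 'a \<Rightarrow> ('a fmon \<Rightarrow>\<^sub>0 int) set" where
  "presented_gen S R a = genideal (free_alg S) R +>\<^bsub>free_alg S\<^esub> gen a"

lemma free_alg_ring: "ring (free_alg S)"
proof -
  have mult: "p * q \<in> carrier (free_alg S)"
    if "p \<in> carrier (free_alg S)" "q \<in> carrier (free_alg S)" for p q
  proof -
    have "set (letters w) \<subseteq> S" if w: "w \<in> Poly_Mapping.keys (p * q)" for w
    proof -
      obtain u v where "u \<in> Poly_Mapping.keys p" "v \<in> Poly_Mapping.keys q" "w = u + v"
        using w keys_mult[of p q] by blast
      then show ?thesis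
        using \<open>p \<in> _\<close> \<open>q \<in> _\<close> by (auto simp: free_alg_def plus_fmon_def)
    qed
    then show ?thesis by (auto simp: free_alg_def)
  qed
  have add: "p + q \<in> carrier (free_alg S)"
    if "p \<in> carrier (free_alg S)" "q \<in> carrier (free_alg S)" for p q
    using that Poly_Mapping.keys_add[of p q] by (auto simp: free_alg_def)
  have one: "0 \<in> carrier (free_alg S)" "1 \<in> carrier (free_alg S)"
    by (auto simp: free_alg_def zero_fmon_def)
  have ops: "p \<otimes>\<^bsub>free_alg S\<^esub> q = p * q" "p \<oplus>\<^bsub>free_alg S\<^esub> q = p + q"
    "\<one>\<^bsub>free_alg S\<^esub> = 1" "\<zero>\<^bsub>free_alg S\<^esub> = 0" for p q
    by (simp_all add: free_alg_def)
  show ?thesis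
  proof (rule ringI)
    show "abelian_group (free_alg S)"
    proof (rule abelian_groupI)
      fix p assume p: "p \<in> carrier (free_alg S)"
      show "\<exists>q\<in>carrier (free_alg S). q \<oplus>\<^bsub>free_alg S\<^esub> p = \<zero>\<^bsub>free_alg S\<^esub>"
        using p by (intro bexI[of _ "- p"]) (auto simp: free_alg_def)
    qed (simp_all add: add one ops ac_simps)
    show "monoid (free_alg S)"
      by (rule monoidI) (simp_all add: mult one ops mult.assoc)
  qed (simp_all add: ops distrib_left distrib_right)
qed

lemma free_alg_closed:
  assumes "p \<in> carrier (free_alg S)" "q \<in> carrier (free_alg S)"
  shows "p + q \<in> carrier (free_alg S)" "p * q \<in> carrier (free_alg S)"
    "p - q \<in> carrier (free_alg S)"
proof -
  interpret ring "free_alg S" by (rule free_alg_ring)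
  have add: "a + b \<in> carrier (free_alg S)"
    if "a \<in> carrier (free_alg S)" "b \<in> carrier (free_alg S)" for a b
    using a_closed[OF that] by (simp add: free_alg_def)
  have neg: "- a \<in> carrier (free_alg S)" if "a \<in> carrier (free_alg S)" for a
    using that by (simp add: free_alg_def)
  show "p + q \<in> carrier (free_alg S)"
    by (intro add assms)
  show "p * q \<in> carrier (free_alg S)"
    using m_closed[OF assms] by (simp add: free_alg_def)
  show "p - q \<in> carrier (free_alg S)"
    using add[OF assms(1) neg[OF assms(2)]] by simp
qed

lemma uminus_in_free_alg: "p \<in> carrier (free_alg S) \<Longrightarrow> - p \<in> carrier (free_alg S)"
  by (simp add: free_alg_def)

lemma one_in_free_alg: "1 \<in> carrier (free_alg S)"
  by (auto simp: free_alg_def zero_fmon_def)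

lemma gen_in_free_alg: "a \<in> S \<Longrightarrow> gen a \<in> carrier (free_alg S)"
  by (auto simp: free_alg_def gen_def)

lemma presented_ring:
  assumes "R \<subseteq> carrier (free_alg S)"
  shows "ring (presented S R)"
  unfolding presented_def
  using assms free_alg_ring ideal.quotient_is_ring ring.genideal_ideal by blast


section \<open>The ring of \<open>\<int>\<close>-linear operators\<close>

text \<open>Operators on \<open>M\<close> are made \<^const>\<open>extensional\<close>, so that they are equal as soon as they agree
  on the carrier. Being \<open>\<int>\<close>-linear is the same as being additive.\<close>

definition End_ring :: "('a, 'b) ring_scheme \<Rightarrow> ('a \<Rightarrow> 'a) ring" where
  "End_ring M =
     \<lparr>carrier = hom (add_monoid M) (add_monoid M) \<inter> extensional (carrier M),
      mult = compose (carrier M),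
      one = (\<lambda>f\<in>carrier M. f),
      zero = (\<lambda>f\<in>carrier M. \<zero>\<^bsub>M\<^esub>),
      add = (\<lambda>D E. \<lambda>f\<in>carrier M. D f \<oplus>\<^bsub>M\<^esub> E f)\<rparr>"

definition left_mult :: "('a, 'b) ring_scheme \<Rightarrow> 'a \<Rightarrow> 'a \<Rightarrow> 'a" where
  "left_mult M a = (\<lambda>f\<in>carrier M. a \<otimes>\<^bsub>M\<^esub> f)"

lemma End_ring_ring:
  fixes M (structure)
  assumes "ring M"
  shows "ring (End_ring M)"
proof -
  interpret ring M by fact
  have ext: "D = E" if "D \<in> carrier (End_ring M)" "E \<in> carrier (End_ring M)"
    "\<And>f. f \<in> carrier M \<Longrightarrow> D f = E f" for D E
    using that by (auto simp: End_ring_def intro: extensionalityI)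
  have cl: "D f \<in> carrier M" if "D \<in> carrier (End_ring M)" "f \<in> carrier M" for D f
    using that by (auto simp: End_ring_def hom_def)
  have ad: "D (f \<oplus> g) = D f \<oplus> D g"
    if "D \<in> carrier (End_ring M)" "f \<in> carrier M" "g \<in> carrier M" for D f g
    using that by (auto simp: End_ring_def hom_def)
  have I: "D \<in> carrier (End_ring M)"
    if "D \<in> extensional (carrier M)" "\<And>f. f \<in> carrier M \<Longrightarrow> D f \<in> carrier M"
      "\<And>f g. f \<in> carrier M \<Longrightarrow> g \<in> carrier M \<Longrightarrow> D (f \<oplus> g) = D f \<oplus> D g" for D
    using that by (auto simp: End_ring_def hom_def)
  have add: "D \<oplus>\<^bsub>End_ring M\<^esub> E = (\<lambda>f\<in>carrier M. D f \<oplus> E f)" for D E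
    by (simp add: End_ring_def)
  have mult: "D \<otimes>\<^bsub>End_ring M\<^esub> E = (\<lambda>f\<in>carrier M. D (E f))" for D E
    by (simp add: End_ring_def compose_def)
  have one: "\<one>\<^bsub>End_ring M\<^esub> = (\<lambda>f\<in>carrier M. f)"
    by (simp add: End_ring_def)
  have zero: "\<zero>\<^bsub>End_ring M\<^esub> = (\<lambda>f\<in>carrier M. \<zero>)"
    by (simp add: End_ring_def)
  have addc: "D \<oplus>\<^bsub>End_ring M\<^esub> E \<in> carrier (End_ring M)"
    if "D \<in> carrier (End_ring M)" "E \<in> carrier (End_ring M)" for D E
    unfolding add using that by (intro I) (auto simp: cl ad a_ac)
  have multc: "D \<otimes>\<^bsub>End_ring M\<^esub> E \<in> carrier (End_ring M)"
    if "D \<in> carrier (End_ring M)" "E \<in> carrier (End_ring M)" for D E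
    unfolding mult using that by (intro I) (auto simp: cl ad)
  have onec: "\<one>\<^bsub>End_ring M\<^esub> \<in> carrier (End_ring M)"
    unfolding one by (intro I) auto
  have zeroc: "\<zero>\<^bsub>End_ring M\<^esub> \<in> carrier (End_ring M)"
    unfolding zero by (intro I) auto
  note closed = addc multc onec zeroc
  note ops = add mult one zero
  show ?thesis
  proof (rule ringI)
    show "abelian_group (End_ring M)"
    proof (rule abelian_groupI)
      fix D assume D: "D \<in> carrier (End_ring M)"
      have "(\<lambda>f\<in>carrier M. \<ominus> D f) \<in> carrier (End_ring M)"
        using D by (intro I) (auto simp: cl ad minus_add)
      moreover from this have "(\<lambda>f\<in>carrier M. \<ominus> D f) \<oplus>\<^bsub>End_ring M\<^esub> D = \<zero>\<^bsub>End_ring M\<^esub>"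
        using D by (intro ext closed) (auto simp: ops cl l_neg)
      ultimately show "\<exists>E\<in>carrier (End_ring M). E \<oplus>\<^bsub>End_ring M\<^esub> D = \<zero>\<^bsub>End_ring M\<^esub>"
        by blast
    next
      fix D E assume "D \<in> carrier (End_ring M)" "E \<in> carrier (End_ring M)"
      then show "D \<oplus>\<^bsub>End_ring M\<^esub> E = E \<oplus>\<^bsub>End_ring M\<^esub> D"
        by (intro ext closed) (simp_all add: add cl a_comm)
    next
      fix D E F
      assume "D \<in> carrier (End_ring M)" "E \<in> carrier (End_ring M)" "F \<in> carrier (End_ring M)"
      then show "D \<oplus>\<^bsub>End_ring M\<^esub> E \<oplus>\<^bsub>End_ring M\<^esub> F = D \<oplus>\<^bsub>End_ring M\<^esub> (E \<oplus>\<^bsub>End_ring M\<^esub> F)"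
        by (intro ext closed) (simp_all add: add cl a_assoc)
    next
      fix D assume "D \<in> carrier (End_ring M)"
      then show "\<zero>\<^bsub>End_ring M\<^esub> \<oplus>\<^bsub>End_ring M\<^esub> D = D"
        by (intro ext closed) (simp_all add: add zero cl)
    qed (use closed in auto)
    show "monoid (End_ring M)"
    proof (rule monoidI)
      fix D E F
      assume "D \<in> carrier (End_ring M)" "E \<in> carrier (End_ring M)" "F \<in> carrier (End_ring M)"
      then show "D \<otimes>\<^bsub>End_ring M\<^esub> E \<otimes>\<^bsub>End_ring M\<^esub> F = D \<otimes>\<^bsub>End_ring M\<^esub> (E \<otimes>\<^bsub>End_ring M\<^esub> F)"
        by (intro ext closed) (simp_all add: mult cl)
    next
      fix D assume "D \<in> carrier (End_ring M)"
      then show "\<one>\<^bsub>End_ring M\<^esub> \<otimes>\<^bsub>End_ring M\<^esub> D = D" "D \<otimes>\<^bsub>End_ring M\<^esub> \<one>\<^bsub>End_ring M\<^esub> = D"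
        by (intro ext closed; simp add: mult one cl)+
    qed (use closed in auto)
  next
    fix D E F
    assume "D \<in> carrier (End_ring M)" "E \<in> carrier (End_ring M)" "F \<in> carrier (End_ring M)"
    then show "(D \<oplus>\<^bsub>End_ring M\<^esub> E) \<otimes>\<^bsub>End_ring M\<^esub> F
        = D \<otimes>\<^bsub>End_ring M\<^esub> F \<oplus>\<^bsub>End_ring M\<^esub> E \<otimes>\<^bsub>End_ring M\<^esub> F"
      "F \<otimes>\<^bsub>End_ring M\<^esub> (D \<oplus>\<^bsub>End_ring M\<^esub> E)
        = F \<otimes>\<^bsub>End_ring M\<^esub> D \<oplus>\<^bsub>End_ring M\<^esub> F \<otimes>\<^bsub>End_ring M\<^esub> E"
      by (intro ext closed; simp add: add mult cl ad)+
  qed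
qed


section \<open>The skew-polynomial algebra\<close>

definition pol_rels :: "nat \<Rightarrow> (nat fmon \<Rightarrow>\<^sub>0 int) set" where
  "pol_rels n =
     {gen i * gen j + gen j * gen i | i j. i \<in> {1..n} \<and> j \<in> {1..n} \<and> i \<noteq> j}"

definition Pol :: "nat \<Rightarrow> (nat fmon \<Rightarrow>\<^sub>0 int) set ring" where
  "Pol n = presented {1..n} (pol_rels n)"

definition pol_x :: "nat \<Rightarrow> nat \<Rightarrow> (nat fmon \<Rightarrow>\<^sub>0 int) set" where
  "pol_x n i = presented_gen {1..n} (pol_rels n) i"


section \<open>The spin type B nilHecke algebra\<close>

text \<open>\<open>X i\<close>, \<open>D i\<close> and \<open>DB\<close> name the generators \<open>x\<^sub>i\<close>, \<open>\<partial>\<^sub>i\<^sup>-\<close> and \<open>\<partial>\<^sub>n\<^sup>B\<close>.\<close>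

datatype nh_gen = X nat | D nat | DB

definition nh_gens :: "nat \<Rightarrow> nh_gen set" where
  "nh_gens n = X ` {1..n} \<union> D ` {1..<n} \<union> {DB}"

abbreviation (input) gX :: "nat \<Rightarrow> (nh_gen fmon \<Rightarrow>\<^sub>0 int)" where "gX i \<equiv> gen (X i)"
abbreviation (input) gD :: "nat \<Rightarrow> (nh_gen fmon \<Rightarrow>\<^sub>0 int)" where "gD i \<equiv> gen (D i)"
abbreviation (input) gDB :: "nh_gen fmon \<Rightarrow>\<^sub>0 int" where "gDB \<equiv> gen DB"

text \<open>Each defining relation \<open>l = r\<close> is recorded as the element \<open>l - r\<close>.\<close>

inductive_set nh_rels :: "nat \<Rightarrow> (nh_gen fmon \<Rightarrow>\<^sub>0 int) set" for n :: nat where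
  X_X: "\<lbrakk>i \<in> {1..n}; j \<in> {1..n}; i \<noteq> j\<rbrakk> \<Longrightarrow> gX i * gX j + gX j * gX i \<in> nh_rels n"
| D_sq: "i \<in> {1..<n} \<Longrightarrow> gD i * gD i \<in> nh_rels n"
| D_braid: "\<lbrakk>i \<in> {1..<n}; i + 1 \<in> {1..<n}\<rbrakk> \<Longrightarrow>
    gD i * gD (i + 1) * gD i - gD (i + 1) * gD i * gD (i + 1) \<in> nh_rels n"
| D_D: "\<lbrakk>i \<in> {1..<n}; j \<in> {1..<n}; \<bar>int i - int j\<bar> > 1\<rbrakk> \<Longrightarrow>
    gD i * gD j + gD j * gD i \<in> nh_rels n"
| X_D: "i \<in> {1..<n} \<Longrightarrow> gX i * gD i + gD i * gX (i + 1) - 1 \<in> nh_rels n"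
| D_X: "i \<in> {1..<n} \<Longrightarrow> gD i * gX i + gX (i + 1) * gD i - 1 \<in> nh_rels n"
| D_X_far: "\<lbrakk>i \<in> {1..<n}; j \<in> {1..n}; j \<noteq> i; j \<noteq> i + 1\<rbrakk> \<Longrightarrow>
    gD i * gX j + gX j * gD i \<in> nh_rels n"
| DB_sq: "gDB * gDB \<in> nh_rels n"
| DB_braid: "n \<ge> 2 \<Longrightarrow>
    gDB * gD (n - 1) * gDB * gD (n - 1) - (- (gD (n - 1) * gDB * gD (n - 1) * gDB)) \<in> nh_rels n"
| DB_D: "\<lbrakk>1 \<le> i; i + 2 \<le> n\<rbrakk> \<Longrightarrow> gDB * gD i + gD i * gDB \<in> nh_rels n"
| DB_X: "gDB * gX n + gX n * gDB - 1 \<in> nh_rels n"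
| DB_X_far: "i \<in> {1..<n} \<Longrightarrow> gDB * gX i + gX i * gDB \<in> nh_rels n"

definition NH_B :: "nat \<Rightarrow> (nh_gen fmon \<Rightarrow>\<^sub>0 int) set ring" where
  "NH_B n = presented (nh_gens n) (nh_rels n)"

definition nh_x :: "nat \<Rightarrow> nat \<Rightarrow> (nh_gen fmon \<Rightarrow>\<^sub>0 int) set" where
  "nh_x n i = presented_gen (nh_gens n) (nh_rels n) (X i)"

definition nh_d :: "nat \<Rightarrow> nat \<Rightarrow> (nh_gen fmon \<Rightarrow>\<^sub>0 int) set" where
  "nh_d n i = presented_gen (nh_gens n) (nh_rels n) (D i)"

definition nh_dB :: "nat \<Rightarrow> (nh_gen fmon \<Rightarrow>\<^sub>0 int) set" where
  "nh_dB n = presented_gen (nh_gens n) (nh_rels n) DB"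

text \<open>The relators have to lie in the free algebra: otherwise \<^const>\<open>genideal\<close> would be an
  intersection over the empty family.\<close>

lemma pol_rels_carrier: "pol_rels n \<subseteq> carrier (free_alg {1..n})"
  unfolding pol_rels_def by (blast intro: free_alg_closed gen_in_free_alg)

lemma nh_rels_carrier:
  assumes "n \<ge> 1"
  shows "nh_rels n \<subseteq> carrier (free_alg (nh_gens n))"
proof
  have x: "gX i \<in> carrier (free_alg (nh_gens n))" if "i \<in> {1..n}" for i
    using that by (intro gen_in_free_alg) (simp add: nh_gens_def)
  have d: "gD i \<in> carrier (free_alg (nh_gens n))" if "i \<in> {1..<n}" for i
    using that by (intro gen_in_free_alg) (simp add: nh_gens_def)
  have b: "gDB \<in> carrier (free_alg (nh_gens n))"
    by (intro gen_in_free_alg) (simp add: nh_gens_def)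
  fix r assume "r \<in> nh_rels n"
  then show "r \<in> carrier (free_alg (nh_gens n))"
    by cases (simp only:, intro free_alg_closed uminus_in_free_alg one_in_free_alg x d b; use assms in simp)+
qed

lemma Pol_ring: "ring (Pol n)"
  unfolding Pol_def by (rule presented_ring[OF pol_rels_carrier])

lemma NH_B_ring: "n \<ge> 1 \<Longrightarrow> ring (NH_B n)"
  unfolding NH_B_def by (rule presented_ring[OF nh_rels_carrier])


section \<open>Type B odd Demazure operators\<close>

text \<open>The endomorphisms and operators are the unique extensional functions with the
  properties listed: they are determined by their values on the generators, and extensionality
  fixes them off the carrier. No existence is assumed: that they are well defined on the
  quotient has to be proved before anything can be said about these constants.\<close>

definition s_op :: "nat \<Rightarrow> nat \<Rightarrow> (nat fmon \<Rightarrow>\<^sub>0 int) set \<Rightarrow> (nat fmon \<Rightarrow>\<^sub>0 int) set" where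
  "s_op n i = (THE s.
     s \<in> ring_hom (Pol n) (Pol n) \<inter> extensional (carrier (Pol n)) \<and>
     s (pol_x n i) = \<ominus>\<^bsub>Pol n\<^esub> pol_x n (i + 1) \<and>
     s (pol_x n (i + 1)) = \<ominus>\<^bsub>Pol n\<^esub> pol_x n i \<and>
     (\<forall>j\<in>{1..n}. j \<noteq> i \<and> j \<noteq> i + 1 \<longrightarrow> s (pol_x n j) = \<ominus>\<^bsub>Pol n\<^esub> pol_x n j))"

definition sB_op :: "nat \<Rightarrow> (nat fmon \<Rightarrow>\<^sub>0 int) set \<Rightarrow> (nat fmon \<Rightarrow>\<^sub>0 int) set" where
  "sB_op n = (THE s.
     s \<in> ring_hom (Pol n) (Pol n) \<inter> extensional (carrier (Pol n)) \<and>
     (\<forall>j\<in>{1..n}. s (pol_x n j) = \<ominus>\<^bsub>Pol n\<^esub> pol_x n j))"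

definition demazure :: "nat \<Rightarrow> nat \<Rightarrow> (nat fmon \<Rightarrow>\<^sub>0 int) set \<Rightarrow> (nat fmon \<Rightarrow>\<^sub>0 int) set" where
  "demazure n i = (THE d.
     d \<in> carrier (End_ring (Pol n)) \<and>
     d \<one>\<^bsub>Pol n\<^esub> = \<zero>\<^bsub>Pol n\<^esub> \<and>
     (\<forall>j\<in>{1..n}. d (pol_x n j) = (if j \<in> {i, i + 1} then \<one>\<^bsub>Pol n\<^esub> else \<zero>\<^bsub>Pol n\<^esub>)) \<and>
     (\<forall>f\<in>carrier (Pol n). \<forall>g\<in>carrier (Pol n).
        d (f \<otimes>\<^bsub>Pol n\<^esub> g) = d f \<otimes>\<^bsub>Pol n\<^esub> g \<oplus>\<^bsub>Pol n\<^esub> s_op n i f \<otimes>\<^bsub>Pol n\<^esub> d g))"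

definition demazureB :: "nat \<Rightarrow> (nat fmon \<Rightarrow>\<^sub>0 int) set \<Rightarrow> (nat fmon \<Rightarrow>\<^sub>0 int) set" where
  "demazureB n = (THE d.
     d \<in> carrier (End_ring (Pol n)) \<and>
     d \<one>\<^bsub>Pol n\<^esub> = \<zero>\<^bsub>Pol n\<^esub> \<and>
     (\<forall>j\<in>{1..n}. d (pol_x n j) = (if j = n then \<one>\<^bsub>Pol n\<^esub> else \<zero>\<^bsub>Pol n\<^esub>)) \<and>
     (\<forall>f\<in>carrier (Pol n). \<forall>g\<in>carrier (Pol n).
        d (f \<otimes>\<^bsub>Pol n\<^esub> g) = d f \<otimes>\<^bsub>Pol n\<^esub> g \<oplus>\<^bsub>Pol n\<^esub> sB_op n f \<otimes>\<^bsub>Pol n\<^esub> d g))"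

end

theory Submission
  imports Defs "HOL-Combinatorics.Transposition"
begin

text \<open>A ring homomorphism out of a ring given by generators and relations is a choice of images of
  the generators under which every relator becomes zero (\<open>presented_hom_exists\<close>). This
  is used twice: to show that the odd Demazure operators exist, and to turn the relations between
  them into a representation.

  Existence. For a ring endomorphism \<open>s\<close>, an additive map \<open>d\<close> satisfies
  \<open>d (f g) = d f g + s f d g\<close> exactly if sending \<open>f\<close> to the triangular matrix with diagonal
  \<open>(s f, f)\<close> and upper right entry \<open>d f\<close> is multiplicative. So \<open>s\<close> and \<open>d\<close> may be prescribed
  freely on the generators, provided that the matrices attached to the \<open>x\<^sub>j\<close> anticommute
  (\<open>presented_twisted_derivation_exists\<close>). All operators in question are instances of one
  family: for a permutation \<open>\<pi>\<close> of the indices and a set \<open>T\<close> of indices, the twist sends \<open>x\<^sub>j\<close> to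
  \<open>- x\<^bsub>\<pi> j\<^esub>\<close> and the operator sends \<open>x\<^sub>j\<close> to \<open>1\<close> or \<open>0\<close> according to whether \<open>j \<in> T\<close>
  (\<open>odd_derivation\<close>). The operator \<open>\<partial>\<^sub>i\<close> belongs to the transposition of \<open>T = {i, i + 1}\<close>, and the
  type B operator to the identity and \<open>T = {n}\<close>.

  Relations. The Leibniz rule gives the commutation rule
  \<open>d (x\<^sub>j f) = [j \<in> T] f - x\<^bsub>\<pi> j\<^esub> d f\<close>, which already contains all relations between
  some \<open>x\<^sub>j\<close> and one of the operators. Every skew polynomial arises from \<open>1\<close> by
  differences and left multiplications by the \<open>x\<^sub>j\<close> (\<open>pol_induct\<close>), so an identity \<open>W = 0\<close> between
  words in the operators follows from \<open>W 1 = 0\<close>, which is clear, and from the step from \<open>W f = 0\<close>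
  to \<open>W (x\<^sub>j f) = 0\<close>. In that step \<open>x\<^sub>j\<close> is moved to the left through each word: the terms in which
  it survives combine to a multiple of \<open>W f\<close>, and the shorter words left over cancel.\<close>

section \<open>Homomorphisms out of a ring with generators and relations\<close>

context ring
begin

definition eval_word :: "('g \<Rightarrow> 'a) \<Rightarrow> 'g fmon \<Rightarrow> 'a" where
  "eval_word \<phi> w = foldr (\<lambda>a r. \<phi> a \<otimes> r) (letters w) \<one>"

definition eval_poly :: "('g \<Rightarrow> 'a) \<Rightarrow> ('g fmon \<Rightarrow>\<^sub>0 int) \<Rightarrow> 'a" where
  "eval_poly \<phi> p =
     (\<Oplus>w\<in>Poly_Mapping.keys p. [Poly_Mapping.lookup p w] \<cdot> eval_word \<phi> w)"

lemma eval_word_closed [simp]: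
  assumes "\<And>a. \<phi> a \<in> carrier R"
  shows "eval_word \<phi> w \<in> carrier R"
proof -
  have "foldr (\<lambda>a r. \<phi> a \<otimes> r) l \<one> \<in> carrier R" for l
    using assms by (induction l) auto
  then show ?thesis by (simp add: eval_word_def)
qed

lemma eval_word_add:
  assumes "\<And>a. \<phi> a \<in> carrier R"
  shows "eval_word \<phi> (u + v) = eval_word \<phi> u \<otimes> eval_word \<phi> v"
proof -
  have "eval_word \<phi> (Word (l @ letters v)) = eval_word \<phi> (Word l) \<otimes> eval_word \<phi> v" for l
  proof (induction l)
    case Nil
    have "eval_word \<phi> (Word []) = \<one>"
      by (simp add: eval_word_def)
    then show ?case using assms by simp
  next
    case (Cons a l)
    have "eval_word \<phi> (Word (a # m)) = \<phi> a \<otimes> eval_word \<phi> (Word m)" for m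
      by (simp add: eval_word_def)
    with Cons show ?case using assms by (simp add: m_assoc)
  qed
  from this [of "letters u"] show ?thesis by (simp add: plus_fmon_def)
qed

text \<open>Two polynomials are compared by summing over a common support.\<close>

lemma eval_poly_superset:
  assumes "\<And>a. \<phi> a \<in> carrier R" "finite A" "Poly_Mapping.keys p \<subseteq> A"
  shows "eval_poly \<phi> p = (\<Oplus>w\<in>A. [Poly_Mapping.lookup p w] \<cdot> eval_word \<phi> w)"
proof -
  have "[(0::int)] \<cdot> eval_word \<phi> w = \<zero>" for w
    by (simp add: add_pow_def)
  then show ?thesis
    unfolding eval_poly_def using assms
    by (intro add.finprod_mono_neutral_cong_left) (auto simp: in_keys_iff add.int_pow_closed)
qed

lemma eval_poly_closed [simp]:
  assumes "\<And>a. \<phi> a \<in> carrier R"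
  shows "eval_poly \<phi> p \<in> carrier R"
  unfolding eval_poly_def using assms by (intro finsum_closed) (auto intro: add.int_pow_closed)

lemma eval_poly_add:
  assumes "\<And>a. \<phi> a \<in> carrier R"
  shows "eval_poly \<phi> (p + q) = eval_poly \<phi> p \<oplus> eval_poly \<phi> q"
proof -
  let ?A = "Poly_Mapping.keys p \<union> Poly_Mapping.keys q"
  have "eval_poly \<phi> (p + q) = (\<Oplus>w\<in>?A. [Poly_Mapping.lookup (p + q) w] \<cdot> eval_word \<phi> w)"
    using Poly_Mapping.keys_add[of p q] assms by (intro eval_poly_superset) auto
  also have "\<dots> = (\<Oplus>w\<in>?A. [Poly_Mapping.lookup p w] \<cdot> eval_word \<phi> w
                        \<oplus> [Poly_Mapping.lookup q w] \<cdot> eval_word \<phi> w)"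
    using assms
    by (intro finsum_cong') (auto simp: lookup_add add.int_pow_mult intro: add.int_pow_closed)
  also have "\<dots> = eval_poly \<phi> p \<oplus> eval_poly \<phi> q"
    using assms by (subst finsum_addf)
      (auto simp: eval_poly_superset[of \<phi> ?A] intro: add.int_pow_closed)
  finally show ?thesis .
qed

lemma eval_poly_monom:
  assumes "\<And>a. \<phi> a \<in> carrier R"
  shows "eval_poly \<phi> (Poly_Mapping.single w 1) = eval_word \<phi> w"
proof -
  have "eval_poly \<phi> (Poly_Mapping.single w 1) = (\<Oplus>v\<in>{w}. eval_word \<phi> v)"
    unfolding eval_poly_def using assms by (intro finsum_cong') (auto simp: add.int_pow_1)
  then show ?thesis
    using assms by simp
qed

lemma eval_poly_zero: "eval_poly \<phi> 0 = \<zero>"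
  by (simp add: eval_poly_def)

lemma eval_poly_diff:
  assumes "\<And>a. \<phi> a \<in> carrier R"
  shows "eval_poly \<phi> (p - q) = eval_poly \<phi> p \<ominus> eval_poly \<phi> q"
proof -
  have "eval_poly \<phi> p = eval_poly \<phi> (p - q) \<oplus> eval_poly \<phi> q"
    using eval_poly_add[where \<phi> = \<phi> and p = "p - q" and q = q] assms by simp
  then show ?thesis
    using assms by (simp add: a_minus_def a_assoc r_neg)
qed

text \<open>By biadditivity it suffices to multiply two words.\<close>

lemma eval_poly_mult:
  assumes "\<And>a. \<phi> a \<in> carrier R"
  shows "eval_poly \<phi> (p * q) = eval_poly \<phi> p \<otimes> eval_poly \<phi> q"
proof -
  note [simp] = assms
  have monom: "eval_poly \<phi> (Poly_Mapping.single u 1 * q) = eval_word \<phi> u \<otimes> eval_poly \<phi> q" for u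
  proof (induction q rule: frag_induction[where S = UNIV, OF subset_UNIV])
    case 1
    show ?case by (simp add: eval_poly_zero)
  next
    case (2 w)
    show ?case by (simp add: mult_single eval_poly_monom eval_word_add)
  next
    case (3 a b)
    then show ?case
      by (simp add: right_diff_distrib eval_poly_diff a_minus_def r_distr r_minus)
  qed
  show ?thesis
  proof (induction p rule: frag_induction[where S = UNIV, OF subset_UNIV])
    case 1
    show ?case by (simp add: eval_poly_zero)
  next
    case (2 w)
    show ?case by (simp add: monom eval_poly_monom)
  next
    case (3 a b)
    then show ?case
      by (simp add: left_diff_distrib eval_poly_diff a_minus_def l_distr l_minus)
  qed
qed

lemma free_alg_hom_exists:
  assumes "\<phi> \<in> S \<rightarrow> carrier R"
  shows "\<exists>h\<in>ring_hom (free_alg S) R. \<forall>a\<in>S. h (gen a) = \<phi> a"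
proof -
  \<comment> \<open>Extended by zero, so that all words can be evaluated and not only those over \<open>S\<close>.\<close>
  define \<psi> where "\<psi> a = (if a \<in> S then \<phi> a else \<zero>)" for a
  have \<psi>: "\<psi> a \<in> carrier R" for a
    using assms by (auto simp: \<psi>_def)
  have "eval_word \<psi> 0 = \<one>"
    by (simp add: eval_word_def zero_fmon_def)
  then have one: "eval_poly \<psi> 1 = \<one>"
    using eval_poly_monom[of \<psi> 0, OF \<psi>] by simp
  have "eval_poly \<psi> \<in> ring_hom (free_alg S) R"
    by (rule ring_hom_memI)
      (simp_all add: \<psi> free_alg_def eval_poly_mult eval_poly_add one)
  moreover have "eval_poly \<psi> (gen a) = \<phi> a" if "a \<in> S" for a
    using that \<psi>[of a] eval_poly_monom[of \<psi> "Word [a]", OF \<psi>]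
    by (simp add: gen_def eval_word_def) (simp add: \<psi>_def)
  ultimately show ?thesis by blast
qed

end

lemma FactRing_carrier_cosetE:
  assumes "U \<in> carrier (A Quot I)"
  obtains a where "a \<in> carrier A" "U = I +>\<^bsub>A\<^esub> a"
  using assms unfolding FactRing_simps by (auto simp: a_r_coset_def)

lemma quotient_hom_exists:
  assumes "ideal I A" "ring B" "h \<in> ring_hom A B" "\<And>r. r \<in> I \<Longrightarrow> h r = \<zero>\<^bsub>B\<^esub>"
  shows "\<exists>k\<in>ring_hom (A Quot I) B. \<forall>a\<in>carrier A. k (I +>\<^bsub>A\<^esub> a) = h a"
proof -
  interpret I: ideal I A by fact
  interpret B: ring B by fact
  interpret h: ring_hom_ring A B h
    by (rule ring_hom_ringI2) (use assms I.ring_axioms B.ring_axioms in auto)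
  \<comment> \<open>Any representative will do, since \<open>h\<close> is constant on cosets.\<close>
  define k where "k U = h (SOME a. a \<in> carrier A \<and> U = I +>\<^bsub>A\<^esub> a)" for U
  have k: "k (I +>\<^bsub>A\<^esub> a) = h a" if a: "a \<in> carrier A" for a
  proof -
    define b where "b = (SOME b. b \<in> carrier A \<and> I +>\<^bsub>A\<^esub> a = I +>\<^bsub>A\<^esub> b)"
    have b: "b \<in> carrier A" "I +>\<^bsub>A\<^esub> a = I +>\<^bsub>A\<^esub> b"
      using someI[of "\<lambda>b. b \<in> carrier A \<and> I +>\<^bsub>A\<^esub> a = I +>\<^bsub>A\<^esub> b" a] a
      unfolding b_def by auto
    then have "a \<ominus>\<^bsub>A\<^esub> b \<in> I"
      using a I.quotient_eq_iff_same_a_r_cos[OF I.ideal_axioms] by blast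
    then have "h a \<ominus>\<^bsub>B\<^esub> h b = \<zero>\<^bsub>B\<^esub>"
      using assms(4)[of "a \<ominus>\<^bsub>A\<^esub> b"] a b(1) by (simp add: a_minus_def)
    moreover have "h a = (h a \<ominus>\<^bsub>B\<^esub> h b) \<oplus>\<^bsub>B\<^esub> h b"
      using a b(1) by (simp add: a_minus_def B.a_assoc B.l_neg)
    ultimately have "h a = h b"
      using b(1) by simp
    then show ?thesis by (simp add: k_def b_def)
  qed
  have cos: "\<exists>a\<in>carrier A. U = I +>\<^bsub>A\<^esub> a" if "U \<in> carrier (A Quot I)" for U
    using that by (meson FactRing_carrier_cosetE)
  have "k \<in> ring_hom (A Quot I) B"
  proof (rule ring_hom_memI)
    fix U assume "U \<in> carrier (A Quot I)"
    then show "k U \<in> carrier B" using cos[of U] k by auto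
  next
    fix U V assume "U \<in> carrier (A Quot I)" "V \<in> carrier (A Quot I)"
    then obtain a b where ab: "a \<in> carrier A" "b \<in> carrier A"
      "U = I +>\<^bsub>A\<^esub> a" "V = I +>\<^bsub>A\<^esub> b"
      using cos[of U] cos[of V] by auto
    then show "k (U \<otimes>\<^bsub>A Quot I\<^esub> V) = k U \<otimes>\<^bsub>B\<^esub> k V"
      using k by (simp add: FactRing_def I.rcoset_mult_add)
    from ab show "k (U \<oplus>\<^bsub>A Quot I\<^esub> V) = k U \<oplus>\<^bsub>B\<^esub> k V"
      using k by (simp add: FactRing_def I.a_rcos_sum)
  next
    show "k \<one>\<^bsub>A Quot I\<^esub> = \<one>\<^bsub>B\<^esub>"
      using k by (simp add: FactRing_def)
  qed
  with k show ?thesis by blast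
qed

text \<open>The relators are to be checked for an arbitrary homomorphism \<open>h\<close> with the prescribed values
  on the generators. In applications \<open>h r\<close> is then computed from the homomorphism laws alone,
  without going back to the evaluation of polynomials.\<close>

theorem presented_hom_exists:
  assumes "ring B" "R \<subseteq> carrier (free_alg S)" "\<phi> \<in> S \<rightarrow> carrier B"
    and relations: "\<And>h r. \<lbrakk>h \<in> ring_hom (free_alg S) B; \<And>a. a \<in> S \<Longrightarrow> h (gen a) = \<phi> a; r \<in> R\<rbrakk>
      \<Longrightarrow> h r = \<zero>\<^bsub>B\<^esub>"
  shows "\<exists>k\<in>ring_hom (presented S R) B. \<forall>a\<in>S. k (presented_gen S R a) = \<phi> a"
proof -
  interpret F: ring "free_alg S" by (rule free_alg_ring)
  obtain h where h: "h \<in> ring_hom (free_alg S) B" "\<And>a. a \<in> S \<Longrightarrow> h (gen a) = \<phi> a"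
    using ring.free_alg_hom_exists[OF assms(1,3)] by blast
  interpret h: ring_hom_ring "free_alg S" B h
    by (rule ring_hom_ringI2) (use assms h free_alg_ring in auto)
  have I: "ideal (genideal (free_alg S) R) (free_alg S)"
    using assms(2) by (rule F.genideal_ideal)
  have "R \<subseteq> a_kernel (free_alg S) B h"
    using relations[OF h] assms(2) unfolding a_kernel_def' by blast
  then have "genideal (free_alg S) R \<subseteq> a_kernel (free_alg S) B h"
    by (rule F.genideal_minimal[OF h.kernel_is_ideal])
  then have "h r = \<zero>\<^bsub>B\<^esub>" if "r \<in> genideal (free_alg S) R" for r
    using that unfolding a_kernel_def' by blast
  from quotient_hom_exists[OF I assms(1) h(1) this]
  obtain k where "k \<in> ring_hom (presented S R) B"
    "\<And>p. p \<in> carrier (free_alg S) \<Longrightarrow> k (genideal (free_alg S) R +>\<^bsub>free_alg S\<^esub> p) = h p"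
    unfolding presented_def by blast
  then show ?thesis
    unfolding presented_gen_def using gen_in_free_alg[of _ S] h(2) by (intro bexI[of _ k]) simp_all
qed

lemma presented_gen_closed:
  assumes "R \<subseteq> carrier (free_alg S)" "a \<in> S"
  shows "presented_gen S R a \<in> carrier (presented S R)"
proof -
  interpret F: ring "free_alg S" by (rule free_alg_ring)
  interpret I: ideal "genideal (free_alg S) R" "free_alg S"
    using assms(1) by (rule F.genideal_ideal)
  show ?thesis
    unfolding presented_def presented_gen_def
    using I.rcos_ring_hom gen_in_free_alg[OF assms(2)] by (rule ring_hom_closed)
qed

lemma presented_relation:
  assumes "R \<subseteq> carrier (free_alg S)" "r \<in> R"
  shows "genideal (free_alg S) R +>\<^bsub>free_alg S\<^esub> r = \<zero>\<^bsub>presented S R\<^esub>"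
proof -
  interpret F: ring "free_alg S" by (rule free_alg_ring)
  interpret I: ideal "genideal (free_alg S) R" "free_alg S"
    using assms(1) by (rule F.genideal_ideal)
  have "r \<in> genideal (free_alg S) R"
    using F.genideal_self assms by blast
  then show ?thesis
    by (simp add: presented_def FactRing_def I.a_rcos_const)
qed

text \<open>Every word arises from \<open>1\<close> by multiplying with generators from the left, and every polynomial
  arises from words by differences, which serve for sums as well as for negatives.\<close>

lemma presented_induct [consumes 2, case_names one minus gen]:
  fixes S R
  defines "Q \<equiv> presented S R"
  assumes "R \<subseteq> carrier (free_alg S)" "f \<in> carrier Q"
    and one: "P \<one>\<^bsub>Q\<^esub>"
    and minus: "\<And>f g. \<lbrakk>f \<in> carrier Q; g \<in> carrier Q; P f; P g\<rbrakk> \<Longrightarrow> P (f \<ominus>\<^bsub>Q\<^esub> g)"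
    and gen: "\<And>a f. \<lbrakk>a \<in> S; f \<in> carrier Q; P f\<rbrakk> \<Longrightarrow> P (presented_gen S R a \<otimes>\<^bsub>Q\<^esub> f)"
  shows "P f"
proof -
  interpret F: ring "free_alg S" by (rule free_alg_ring)
  interpret I: ideal "genideal (free_alg S) R" "free_alg S"
    using assms(2) by (rule F.genideal_ideal)
  interpret Q: ring Q unfolding Q_def using assms(2) by (rule presented_ring)
  define \<pi> where "\<pi> = (+>\<^bsub>free_alg S\<^esub>) (genideal (free_alg S) R)"
  interpret \<pi>: ring_hom_ring "free_alg S" Q \<pi>
    unfolding \<pi>_def Q_def presented_def by (rule I.rcos_ring_hom_ring)
  have ops: "p \<otimes>\<^bsub>free_alg S\<^esub> q = p * q" "p \<oplus>\<^bsub>free_alg S\<^esub> q = p + q"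
    "\<one>\<^bsub>free_alg S\<^esub> = 1" "\<zero>\<^bsub>free_alg S\<^esub> = 0"
    "p \<in> carrier (free_alg S) \<longleftrightarrow> Poly_Mapping.keys p \<subseteq> {w. set (letters w) \<subseteq> S}" for p q
    by (auto simp add: free_alg_def)
  have word: "Poly_Mapping.single (Word l) 1 \<in> carrier (free_alg S)
      \<and> P (\<pi> (Poly_Mapping.single (Word l) 1))" if "set l \<subseteq> S" for l
    using that
  proof (induction l)
    case Nil
    have "Poly_Mapping.single (Word []) 1 = (1 :: 'a fmon \<Rightarrow>\<^sub>0 int)"
      by (metis single_one zero_fmon_def)
    then show ?case using one \<pi>.hom_one F.one_closed by (simp add: ops(3))
  next
    case (Cons a l)
    have "Poly_Mapping.single (Word (a # l)) 1
        = gen a * (Poly_Mapping.single (Word l) 1 :: 'a fmon \<Rightarrow>\<^sub>0 int)"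
      by (simp add: gen_def mult_single plus_fmon_def)
    moreover have "presented_gen S R a = \<pi> (gen a)"
      by (simp add: presented_gen_def \<pi>_def)
    ultimately show ?case
      using Cons gen[of a "\<pi> (Poly_Mapping.single (Word l) 1)"] gen_in_free_alg[of a S]
        \<pi>.hom_mult[of "gen a" "Poly_Mapping.single (Word l) 1"]
        free_alg_closed(2)[of "gen a" S "Poly_Mapping.single (Word l) 1"]
      by (simp add: ops(1))
  qed
  have P_zero: "P \<zero>\<^bsub>Q\<^esub>"
    using minus[OF Q.one_closed Q.one_closed one one] by (simp add: a_minus_def Q.r_neg)
  have poly: "p \<in> carrier (free_alg S) \<and> P (\<pi> p)" if "p \<in> carrier (free_alg S)" for p
    using that[unfolded ops(5)]
  proof (induction p rule: frag_induction)
    case zero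
    show ?case using P_zero \<pi>.hom_zero F.zero_closed by (simp add: ops(4))
  next
    case (one w)
    then show ?case using word[of "letters w"] by simp
  next
    case (diff p q)
    have "\<pi> (p - q) \<oplus>\<^bsub>Q\<^esub> \<pi> q = \<pi> p"
      using diff free_alg_closed(3)[of p S q] \<pi>.hom_add[of "p - q" q] by (simp add: ops(2))
    then have "\<pi> p \<ominus>\<^bsub>Q\<^esub> \<pi> q = \<pi> (p - q) \<oplus>\<^bsub>Q\<^esub> \<pi> q \<ominus>\<^bsub>Q\<^esub> \<pi> q"
      by simp
    then have "\<pi> (p - q) = \<pi> p \<ominus>\<^bsub>Q\<^esub> \<pi> q"
      using diff free_alg_closed(3)[of p S q] by (simp add: a_minus_def Q.a_assoc Q.r_neg)
    then show ?case
      using diff minus[of "\<pi> p" "\<pi> q"] free_alg_closed(3)[of p S q] by simp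
  qed
  obtain p where "p \<in> carrier (free_alg S)" "f = \<pi> p"
    using assms(3) unfolding Q_def presented_def \<pi>_def by (rule FactRing_carrier_cosetE)
  then show ?thesis using poly by blast
qed

section \<open>Twisted derivations and triangular matrices\<close>

lemma End_ring_abelian_group_hom:
  assumes "ring M" "d \<in> carrier (End_ring M)"
  shows "abelian_group_hom M M d"
proof -
  interpret ring M by fact
  show ?thesis
    using assms(2) a_group abelian_group_axioms
    by (intro abelian_group_homI group_hom.intro group_hom_axioms.intro)
      (simp_all add: End_ring_def)
qed

text \<open>The triple \<open>(a, b, c)\<close> stands for the upper triangular matrix with diagonal \<open>(a, c)\<close> and
  upper right entry \<open>b\<close>.\<close>

definition triangular :: "('a, 'b) ring_scheme \<Rightarrow> ('a \<times> 'a \<times> 'a) ring" where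
  "triangular R =
     \<lparr>carrier = carrier R \<times> carrier R \<times> carrier R,
      mult = (\<lambda>(a, b, c) (a', b', c').
        (a \<otimes>\<^bsub>R\<^esub> a', b \<otimes>\<^bsub>R\<^esub> c' \<oplus>\<^bsub>R\<^esub> a \<otimes>\<^bsub>R\<^esub> b', c \<otimes>\<^bsub>R\<^esub> c')),
      one = (\<one>\<^bsub>R\<^esub>, \<zero>\<^bsub>R\<^esub>, \<one>\<^bsub>R\<^esub>),
      zero = (\<zero>\<^bsub>R\<^esub>, \<zero>\<^bsub>R\<^esub>, \<zero>\<^bsub>R\<^esub>),
      add = (\<lambda>(a, b, c) (a', b', c'). (a \<oplus>\<^bsub>R\<^esub> a', b \<oplus>\<^bsub>R\<^esub> b', c \<oplus>\<^bsub>R\<^esub> c'))\<rparr>"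

lemma (in ring) triangular_ring: "ring (triangular R)"
proof (rule ringI)
  show "abelian_group (triangular R)"
  proof (rule abelian_groupI)
    fix t assume t: "t \<in> carrier (triangular R)"
    obtain a b c where "t = (a, b, c)" by (cases t) auto
    with t show "\<exists>u\<in>carrier (triangular R). u \<oplus>\<^bsub>triangular R\<^esub> t = \<zero>\<^bsub>triangular R\<^esub>"
      by (intro bexI[of _ "(\<ominus> a, \<ominus> b, \<ominus> c)"]) (auto simp: triangular_def l_neg)
  qed (auto simp: triangular_def a_ac)
  show "monoid (triangular R)"
    by (rule monoidI) (auto simp: triangular_def m_assoc l_distr r_distr a_ac)
qed (auto simp: triangular_def l_distr r_distr a_ac)

text \<open>The universal property yields a homomorphism into triangular matrices. Its lower right entry
  fixes the generators and hence is the identity, so that the rule for the upper right entry of a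
  product becomes the twisted Leibniz rule.\<close>

theorem presented_twisted_derivation_exists:
  fixes S R
  defines "Q \<equiv> presented S R"
  defines "x \<equiv> presented_gen S R"
  assumes R: "R \<subseteq> carrier (free_alg S)"
    and \<sigma>: "\<sigma> \<in> S \<rightarrow> carrier Q" and \<delta>: "\<delta> \<in> S \<rightarrow> carrier Q"
    and relations: "\<And>h r. \<lbrakk>h \<in> ring_hom (free_alg S) (triangular Q);
      \<And>a. a \<in> S \<Longrightarrow> h (gen a) = (\<sigma> a, \<delta> a, x a); r \<in> R\<rbrakk> \<Longrightarrow> h r = \<zero>\<^bsub>triangular Q\<^esub>"
  shows "\<exists>s\<in>ring_hom Q Q \<inter> extensional (carrier Q). \<exists>d\<in>carrier (End_ring Q).
           (\<forall>a\<in>S. s (x a) = \<sigma> a) \<and> (\<forall>a\<in>S. d (x a) = \<delta> a) \<and> d \<one>\<^bsub>Q\<^esub> = \<zero>\<^bsub>Q\<^esub> \<and>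
           (\<forall>f\<in>carrier Q. \<forall>g\<in>carrier Q.
              d (f \<otimes>\<^bsub>Q\<^esub> g) = d f \<otimes>\<^bsub>Q\<^esub> g \<oplus>\<^bsub>Q\<^esub> s f \<otimes>\<^bsub>Q\<^esub> d g)"
proof -
  interpret Q: ring Q unfolding Q_def using R by (rule presented_ring)
  have x: "x a \<in> carrier Q" if "a \<in> S" for a
    unfolding x_def Q_def using R that by (rule presented_gen_closed)
  have "(\<lambda>a. (\<sigma> a, \<delta> a, x a)) \<in> S \<rightarrow> carrier (triangular Q)"
    using x \<sigma> \<delta> by (auto simp: triangular_def)
  then have "\<exists>k\<in>ring_hom Q (triangular Q). \<forall>a\<in>S. k (x a) = (\<sigma> a, \<delta> a, x a)"
    using relations unfolding Q_def x_def
    by (intro presented_hom_exists) (use R Q.triangular_ring in \<open>auto simp: Q_def\<close>)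
  then obtain k where k: "k \<in> ring_hom Q (triangular Q)"
    "\<And>a. a \<in> S \<Longrightarrow> k (x a) = (\<sigma> a, \<delta> a, x a)"
    by blast
  define k1 k2 k3 where "k1 = fst \<circ> k" "k2 = fst \<circ> snd \<circ> k" "k3 = snd \<circ> snd \<circ> k"
  have k_eq: "k f = (k1 f, k2 f, k3 f)" for f
    by (simp add: k1_k2_k3_def)
  have closed: "k1 f \<in> carrier Q" "k2 f \<in> carrier Q" "k3 f \<in> carrier Q" if "f \<in> carrier Q" for f
    using ring_hom_closed[OF k(1) that] by (simp_all add: triangular_def k_eq)
  have gens: "k1 (x a) = \<sigma> a" "k2 (x a) = \<delta> a" "k3 (x a) = x a" if "a \<in> S" for a
    using k(2)[OF that] by (simp_all add: k_eq)
  have k_one: "k1 \<one>\<^bsub>Q\<^esub> = \<one>\<^bsub>Q\<^esub>" "k2 \<one>\<^bsub>Q\<^esub> = \<zero>\<^bsub>Q\<^esub>" "k3 \<one>\<^bsub>Q\<^esub> = \<one>\<^bsub>Q\<^esub>"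
    using ring_hom_one[OF k(1)] by (simp_all add: triangular_def k_eq)
  have add: "k1 (f \<oplus>\<^bsub>Q\<^esub> g) = k1 f \<oplus>\<^bsub>Q\<^esub> k1 g" "k2 (f \<oplus>\<^bsub>Q\<^esub> g) = k2 f \<oplus>\<^bsub>Q\<^esub> k2 g"
    "k3 (f \<oplus>\<^bsub>Q\<^esub> g) = k3 f \<oplus>\<^bsub>Q\<^esub> k3 g" if "f \<in> carrier Q" "g \<in> carrier Q" for f g
    using ring_hom_add[OF k(1) that] by (simp_all add: triangular_def k_eq)
  have mult: "k1 (f \<otimes>\<^bsub>Q\<^esub> g) = k1 f \<otimes>\<^bsub>Q\<^esub> k1 g"
    "k2 (f \<otimes>\<^bsub>Q\<^esub> g) = k2 f \<otimes>\<^bsub>Q\<^esub> k3 g \<oplus>\<^bsub>Q\<^esub> k1 f \<otimes>\<^bsub>Q\<^esub> k2 g"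
    "k3 (f \<otimes>\<^bsub>Q\<^esub> g) = k3 f \<otimes>\<^bsub>Q\<^esub> k3 g" if "f \<in> carrier Q" "g \<in> carrier Q" for f g
    using ring_hom_mult[OF k(1) that] by (simp_all add: triangular_def k_eq)
  have k3: "k3 f = f" if "f \<in> carrier Q" for f
    using R that unfolding Q_def
  proof (induction f rule: presented_induct)
    case one
    show ?case using k_one(3) by (simp add: Q_def)
  next
    case (minus f g)
    have "k3 (f \<ominus>\<^bsub>Q\<^esub> g) = k3 (f \<ominus>\<^bsub>Q\<^esub> g) \<oplus>\<^bsub>Q\<^esub> k3 g \<ominus>\<^bsub>Q\<^esub> g"
      using minus closed by (simp add: Q_def[symmetric] a_minus_def Q.a_assoc Q.r_neg)
    also have "k3 (f \<ominus>\<^bsub>Q\<^esub> g) \<oplus>\<^bsub>Q\<^esub> k3 g = k3 (f \<ominus>\<^bsub>Q\<^esub> g \<oplus>\<^bsub>Q\<^esub> g)"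
      using minus by (simp add: Q_def[symmetric] add)
    also have "f \<ominus>\<^bsub>Q\<^esub> g \<oplus>\<^bsub>Q\<^esub> g = f"
      using minus by (simp add: Q_def[symmetric] a_minus_def Q.a_assoc Q.l_neg)
    finally show ?case using minus by (simp add: Q_def)
  next
    case (gen a f)
    then show ?case
      using mult(3)[of "x a" f] x gens(3) by (simp add: Q_def x_def)
  qed
  show ?thesis
  proof (intro bexI conjI ballI)
    show "restrict k1 (carrier Q) \<in> ring_hom Q Q \<inter> extensional (carrier Q)"
      using closed add mult k_one by (auto intro!: ring_hom_memI)
    show "restrict k2 (carrier Q) \<in> carrier (End_ring Q)"
      using closed add by (auto simp: End_ring_def hom_def)
  qed (use x gens k_one mult k3 in auto)
qed

lemma presented_hom_unique:
  fixes S R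
  defines "Q \<equiv> presented S R"
  assumes R: "R \<subseteq> carrier (free_alg S)" and B: "ring B"
    and s: "s \<in> ring_hom Q B" and t: "t \<in> ring_hom Q B"
    and gens: "\<And>a. a \<in> S \<Longrightarrow> s (presented_gen S R a) = t (presented_gen S R a)"
    and f: "f \<in> carrier Q"
  shows "s f = t f"
proof -
  have Q: "ring Q" unfolding Q_def using R by (rule presented_ring)
  interpret s: ring_hom_ring Q B s by (rule ring_hom_ringI2[OF Q B s])
  interpret t: ring_hom_ring Q B t by (rule ring_hom_ringI2[OF Q B t])
  show ?thesis
    using R f unfolding Q_def
  proof (induction f rule: presented_induct)
    case one
    show ?case by (simp add: Q_def[symmetric])
  next
    case (minus f g)
    then show ?case by (simp add: Q_def[symmetric] a_minus_def)
  next
    case (gen a f)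
    then show ?case
      using presented_gen_closed[OF R] gens by (simp add: Q_def[symmetric])
  qed
qed

lemma presented_twisted_derivation_unique:
  fixes S R
  defines "Q \<equiv> presented S R"
  assumes R: "R \<subseteq> carrier (free_alg S)"
    and d: "d \<in> carrier (End_ring Q)" and e: "e \<in> carrier (End_ring Q)"
    and one: "d \<one>\<^bsub>Q\<^esub> = e \<one>\<^bsub>Q\<^esub>"
    and gens: "\<And>a. a \<in> S \<Longrightarrow> d (presented_gen S R a) = e (presented_gen S R a)"
    and leibniz: "\<And>f g. \<lbrakk>f \<in> carrier Q; g \<in> carrier Q\<rbrakk> \<Longrightarrow>
        d (f \<otimes>\<^bsub>Q\<^esub> g) = d f \<otimes>\<^bsub>Q\<^esub> g \<oplus>\<^bsub>Q\<^esub> s f \<otimes>\<^bsub>Q\<^esub> d g"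
      "\<And>f g. \<lbrakk>f \<in> carrier Q; g \<in> carrier Q\<rbrakk> \<Longrightarrow>
        e (f \<otimes>\<^bsub>Q\<^esub> g) = e f \<otimes>\<^bsub>Q\<^esub> g \<oplus>\<^bsub>Q\<^esub> s f \<otimes>\<^bsub>Q\<^esub> e g"
  shows "d = e"
proof (rule extensionalityI)
  show "d \<in> extensional (carrier Q)" "e \<in> extensional (carrier Q)"
    using d e by (auto simp: End_ring_def)
  interpret Q: ring Q unfolding Q_def using R by (rule presented_ring)
  interpret d: abelian_group_hom Q Q d
    by (rule End_ring_abelian_group_hom[OF Q.ring_axioms d])
  interpret e: abelian_group_hom Q Q e
    by (rule End_ring_abelian_group_hom[OF Q.ring_axioms e])
  fix f assume "f \<in> carrier Q"
  with R show "d f = e f"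
    unfolding Q_def
  proof (induction f rule: presented_induct)
    case one
    show ?case using \<open>d \<one>\<^bsub>Q\<^esub> = e \<one>\<^bsub>Q\<^esub>\<close> by (simp add: Q_def)
  next
    case (minus f g)
    then show ?case by (simp add: Q_def[symmetric] a_minus_def)
  next
    case (gen a f)
    then show ?case
      using presented_gen_closed[OF R] gens leibniz by (simp add: Q_def[symmetric])
  qed
qed

section \<open>Homomorphism laws on the free algebra\<close>

text \<open>The operations of the free algebra are written with the type class operations on
  polynomials; these are the homomorphism laws in that notation.\<close>

lemma free_alg_hom:
  assumes "h \<in> ring_hom (free_alg S) B" "ring B"
    and "p \<in> carrier (free_alg S)" "q \<in> carrier (free_alg S)"
  shows "h (p + q) = h p \<oplus>\<^bsub>B\<^esub> h q" "h (p * q) = h p \<otimes>\<^bsub>B\<^esub> h q"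
    "h (- p) = \<ominus>\<^bsub>B\<^esub> h p" "h (p - q) = h p \<ominus>\<^bsub>B\<^esub> h q"
proof -
  interpret h: ring_hom_ring "free_alg S" B h
    by (rule ring_hom_ringI2[OF free_alg_ring assms(2,1)])
  have uminus: "- r = \<ominus>\<^bsub>free_alg S\<^esub> r" if "r \<in> carrier (free_alg S)" for r
    using that uminus_in_free_alg[OF that]
    by (intro h.R.minus_equality[symmetric]) (simp_all add: free_alg_def)
  have ops: "p \<otimes>\<^bsub>free_alg S\<^esub> q = p * q" "p \<oplus>\<^bsub>free_alg S\<^esub> q = p + q"
    for p q
    by (simp_all add: free_alg_def)
  show "h (p + q) = h p \<oplus>\<^bsub>B\<^esub> h q"
    using h.hom_add[OF assms(3,4)] by (simp add: ops)
  show "h (p * q) = h p \<otimes>\<^bsub>B\<^esub> h q"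
    using h.hom_mult[OF assms(3,4)] by (simp add: ops)
  show "h (- p) = \<ominus>\<^bsub>B\<^esub> h p"
    using uminus[OF assms(3)] assms(3) by simp
  show "h (p - q) = h p \<ominus>\<^bsub>B\<^esub> h q"
    using h.hom_add[OF assms(3) uminus_in_free_alg[OF assms(4)]] uminus[OF assms(4)] assms
    by (simp add: ops a_minus_def diff_conv_add_uminus del: add_uminus_conv_diff)
qed

lemma presented_projection:
  assumes "R \<subseteq> carrier (free_alg S)"
  obtains h where "h \<in> ring_hom (free_alg S) (presented S R)"
    "\<And>a. h (gen a) = presented_gen S R a" "\<And>r. r \<in> R \<Longrightarrow> h r = \<zero>\<^bsub>presented S R\<^esub>"
proof
  show "(+>\<^bsub>free_alg S\<^esub>) (genideal (free_alg S) R) \<in> ring_hom (free_alg S) (presented S R)"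
    unfolding presented_def
    using ideal.rcos_ring_hom[OF ring.genideal_ideal[OF free_alg_ring assms]] .
qed (simp_all add: presented_gen_def presented_relation[OF assms])

section \<open>Odd derivations of the skew-polynomial algebra\<close>

text \<open>Naming the algebra \<open>P\<close> only serves to write its operations without subscripts.\<close>

locale skew_polynomials =
  fixes n :: nat and P (structure)
  assumes P_eq: "P = Pol n"
begin

sublocale ring P
  unfolding P_eq by (rule Pol_ring)

abbreviation x :: "nat \<Rightarrow> (nat fmon \<Rightarrow>\<^sub>0 int) set" where
  "x \<equiv> pol_x n"

lemma x_closed [simp]: "j \<in> {1..n} \<Longrightarrow> x j \<in> carrier P"
  unfolding P_eq Pol_def pol_x_def by (rule presented_gen_closed[OF pol_rels_carrier])

lemma x_anticommute:
  assumes "i \<in> {1..n}" "j \<in> {1..n}" "i \<noteq> j"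
  shows "x i \<otimes> x j \<oplus> x j \<otimes> x i = \<zero>"
proof -
  obtain h where h: "h \<in> ring_hom (free_alg {1..n}) P" "\<And>j. h (gen j) = x j"
      "\<And>r. r \<in> pol_rels n \<Longrightarrow> h r = \<zero>"
    using presented_projection[OF pol_rels_carrier[of n]] unfolding P_eq Pol_def pol_x_def by blast
  note hom = free_alg_hom[OF h(1) ring_axioms]
  have "gen i * gen j + gen j * gen i \<in> pol_rels n"
    using assms unfolding pol_rels_def by blast
  from h(3)[OF this] show ?thesis
    using assms by (simp add: hom h(2) gen_in_free_alg free_alg_closed)
qed


lemma pol_induct [consumes 1, case_names one minus x]:
  assumes "f \<in> carrier P" "Q \<one>"
    "\<And>f g. \<lbrakk>f \<in> carrier P; g \<in> carrier P; Q f; Q g\<rbrakk> \<Longrightarrow> Q (f \<ominus> g)"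
    "\<And>j f. \<lbrakk>j \<in> {1..n}; f \<in> carrier P; Q f\<rbrakk> \<Longrightarrow> Q (x j \<otimes> f)"
  shows "Q f"
  using pol_rels_carrier assms unfolding P_eq Pol_def pol_x_def
  by (rule presented_induct[where P = Q and f = f])

text \<open>The defining properties of the type A and type B operators, with \<open>\<pi>\<close> and \<open>T\<close> as parameters,
  so that well-definedness and the relations are proved once for both types.\<close>

definition odd_twist :: "(nat \<Rightarrow> nat) \<Rightarrow> (nat fmon \<Rightarrow>\<^sub>0 int) set \<Rightarrow> (nat fmon \<Rightarrow>\<^sub>0 int) set" where
  "odd_twist \<pi> = (THE s. s \<in> ring_hom P P \<inter> extensional (carrier P) \<and>
     (\<forall>j\<in>{1..n}. s (x j) = \<ominus> x (\<pi> j)))"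

definition odd_derivation ::
    "(nat \<Rightarrow> nat) \<Rightarrow> nat set \<Rightarrow> (nat fmon \<Rightarrow>\<^sub>0 int) set \<Rightarrow> (nat fmon \<Rightarrow>\<^sub>0 int) set" where
  "odd_derivation \<pi> T = (THE d. d \<in> carrier (End_ring P) \<and> d \<one> = \<zero> \<and>
     (\<forall>j\<in>{1..n}. d (x j) = (if j \<in> T then \<one> else \<zero>)) \<and>
     (\<forall>f\<in>carrier P. \<forall>g\<in>carrier P. d (f \<otimes> g) = d f \<otimes> g \<oplus> odd_twist \<pi> f \<otimes> d g))"

text \<open>Of the Leibniz rule only the case of a first factor \<open>x\<^sub>j\<close> is kept. It no longer mentions the
  twist, and by \<open>pol_induct\<close> it still determines \<open>d\<close>.\<close>

definition is_odd_derivation ::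
    "(nat \<Rightarrow> nat) \<Rightarrow> nat set \<Rightarrow> ((nat fmon \<Rightarrow>\<^sub>0 int) set \<Rightarrow> (nat fmon \<Rightarrow>\<^sub>0 int) set) \<Rightarrow> bool" where
  "is_odd_derivation \<pi> T d \<longleftrightarrow>
     \<pi> \<in> {1..n} \<rightarrow> {1..n} \<and> d \<in> carrier (End_ring P) \<and> d \<one> = \<zero> \<and>
     (\<forall>j\<in>{1..n}. \<forall>f\<in>carrier P. d (x j \<otimes> f) = (if j \<in> T then f else \<zero>) \<ominus> x (\<pi> j) \<otimes> d f)"

text \<open>The assumption on \<open>T\<close> is what the relators require: the upper right entry of the matrix of
  \<open>x\<^sub>i x\<^sub>j + x\<^sub>j x\<^sub>i\<close> is \<open>[i \<in> T] (x\<^sub>j - x\<^bsub>\<pi> j\<^esub>) + [j \<in> T] (x\<^sub>i - x\<^bsub>\<pi> i\<^esub>)\<close>, whose two summands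
  vanish if \<open>\<pi>\<close> fixes the indices concerned and cancel if \<open>\<pi>\<close> swaps \<open>i\<close> and \<open>j\<close>.\<close>

lemma odd_derivation:
  assumes \<pi>: "\<pi> \<in> {1..n} \<rightarrow> {1..n}" "inj_on \<pi> {1..n}"
    and T: "\<And>j k. \<lbrakk>j \<in> T; j \<in> {1..n}; k \<in> {1..n}; j \<noteq> k\<rbrakk>
      \<Longrightarrow> \<pi> k = k \<or> k \<in> T \<and> \<pi> j = k \<and> \<pi> k = j"
  shows "is_odd_derivation \<pi> T (odd_derivation \<pi> T)"
proof -
  have \<pi>_in: "\<pi> j \<in> {1..n}" if "j \<in> {1..n}" for j
    using \<pi>(1) that by blast
  define \<delta> where "\<delta> j = (if j \<in> T then \<one> else \<zero>)" for j
  have "\<exists>s\<in>ring_hom P P \<inter> extensional (carrier P). \<exists>d\<in>carrier (End_ring P).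
      (\<forall>j\<in>{1..n}. s (x j) = \<ominus> x (\<pi> j)) \<and> (\<forall>j\<in>{1..n}. d (x j) = \<delta> j) \<and> d \<one> = \<zero> \<and>
      (\<forall>f\<in>carrier P. \<forall>g\<in>carrier P. d (f \<otimes> g) = d f \<otimes> g \<oplus> s f \<otimes> d g)"
    unfolding P_eq Pol_def pol_x_def
  proof (rule presented_twisted_derivation_exists[OF pol_rels_carrier];
      (fold Pol_def)?, (fold pol_x_def)?, (fold P_eq)?)
    show "(\<lambda>j. \<ominus> x (\<pi> j)) \<in> {1..n} \<rightarrow> carrier P"
      using \<pi>_in by auto
    show "\<delta> \<in> {1..n} \<rightarrow> carrier P"
      by (auto simp: \<delta>_def)
    fix h r
    assume h: "h \<in> ring_hom (free_alg {1..n}) (triangular P)"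
      "\<And>j. j \<in> {1..n} \<Longrightarrow> h (gen j) = (\<ominus> x (\<pi> j), \<delta> j, x j)" "r \<in> pol_rels n"
    from h(3) obtain i j where r: "r = gen i * gen j + gen j * gen i"
      and ij: "i \<in> {1..n}" "j \<in> {1..n}" "i \<noteq> j"
      unfolding pol_rels_def by blast
    note hom = free_alg_hom[OF h(1) triangular_ring]
    have "\<pi> i \<noteq> \<pi> j"
      using \<pi>(2) ij by (auto dest: inj_onD)
    then have twist_entry: "\<ominus> x (\<pi> i) \<otimes> \<ominus> x (\<pi> j) \<oplus> \<ominus> x (\<pi> j) \<otimes> \<ominus> x (\<pi> i) = \<zero>"
      using ij \<pi>_in x_anticommute by (simp add: l_minus r_minus)
    have derivation_entry: "(\<delta> i \<otimes> x j \<oplus> \<ominus> x (\<pi> i) \<otimes> \<delta> j) \<oplus> (\<delta> j \<otimes> x i \<oplus> \<ominus> x (\<pi> j) \<otimes> \<delta> i) = \<zero>"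
    proof (cases "i \<in> T \<and> j \<in> T \<and> \<pi> i = j \<and> \<pi> j = i")
      case True
      then show ?thesis
        using ij by (simp add: \<delta>_def l_neg r_neg a_ac)
    next
      case False
      then have "i \<in> T \<Longrightarrow> \<pi> j = j" "j \<in> T \<Longrightarrow> \<pi> i = i"
        using ij T[of i j] T[of j i] by auto
      then show ?thesis
        using ij \<pi>_in[of i] \<pi>_in[of j]
        by (cases "i \<in> T"; cases "j \<in> T") (simp_all add: \<delta>_def l_neg r_neg a_assoc r_neg1)
    qed
    show "h r = \<zero>\<^bsub>triangular P\<^esub>"
      using twist_entry derivation_entry ij x_anticommute
      by (simp add: r hom h(2) gen_in_free_alg free_alg_closed triangular_def)
  qed
  then obtain s d where s: "s \<in> ring_hom P P" "s \<in> extensional (carrier P)"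
      "\<And>j. j \<in> {1..n} \<Longrightarrow> s (x j) = \<ominus> x (\<pi> j)"
    and d: "d \<in> carrier (End_ring P)" "\<And>j. j \<in> {1..n} \<Longrightarrow> d (x j) = \<delta> j" "d \<one> = \<zero>"
      "\<And>f g. \<lbrakk>f \<in> carrier P; g \<in> carrier P\<rbrakk> \<Longrightarrow> d (f \<otimes> g) = d f \<otimes> g \<oplus> s f \<otimes> d g"
    by blast
  have twist: "odd_twist \<pi> = s"
    unfolding odd_twist_def
  proof (rule the_equality)
    fix t assume t: "t \<in> ring_hom P P \<inter> extensional (carrier P) \<and>
      (\<forall>j\<in>{1..n}. t (x j) = \<ominus> x (\<pi> j))"
    have "t f = s f" if "f \<in> carrier P" for f
      using presented_hom_unique[OF pol_rels_carrier[of n] ring_axioms, of t s f] t s that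
      unfolding P_eq Pol_def pol_x_def by auto
    then show "t = s"
      using s(2) t by (intro extensionalityI[of t "carrier P" s]) auto
  qed (use s in auto)
  have "odd_derivation \<pi> T = d"
    unfolding odd_derivation_def twist
  proof (rule the_equality)
    fix e assume e: "e \<in> carrier (End_ring P) \<and> e \<one> = \<zero> \<and>
     (\<forall>j\<in>{1..n}. e (x j) = (if j \<in> T then \<one> else \<zero>)) \<and>
     (\<forall>f\<in>carrier P. \<forall>g\<in>carrier P. e (f \<otimes> g) = e f \<otimes> g \<oplus> s f \<otimes> e g)"
    show "e = d"
      by (rule presented_twisted_derivation_unique[OF pol_rels_carrier[of n], of e d s])
        (use e d in \<open>auto simp: \<delta>_def P_eq Pol_def pol_x_def\<close>)
  qed (use d in \<open>auto simp: \<delta>_def\<close>)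
  moreover have "d f \<in> carrier P" if "f \<in> carrier P" for f
    using d(1) that by (auto simp: End_ring_def hom_def)
  ultimately show ?thesis
    using d s \<pi> \<pi>_in by (auto simp: is_odd_derivation_def \<delta>_def l_minus a_minus_def)
qed

end

context skew_polynomials
begin

section \<open>Relations between odd derivations\<close>

lemma is_odd_derivation_simps:
  assumes "is_odd_derivation \<pi> T d"
  shows "f \<in> carrier P \<Longrightarrow> d f \<in> carrier P"
    and "\<lbrakk>f \<in> carrier P; g \<in> carrier P\<rbrakk> \<Longrightarrow> d (f \<oplus> g) = d f \<oplus> d g"
    and "f \<in> carrier P \<Longrightarrow> d (\<ominus> f) = \<ominus> d f"
    and "d \<zero> = \<zero>" and "d \<one> = \<zero>"
    and "\<lbrakk>j \<in> {1..n}; f \<in> carrier P\<rbrakk> \<Longrightarrow>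
      d (x j \<otimes> f) = (if j \<in> T then f else \<zero>) \<oplus> \<ominus> (x (\<pi> j) \<otimes> d f)"
    and "j \<in> {1..n} \<Longrightarrow> \<pi> j \<in> {1..n}"
proof -
  interpret d: abelian_group_hom P P d
    using assms End_ring_abelian_group_hom[OF ring_axioms] by (simp add: is_odd_derivation_def)
  show "f \<in> carrier P \<Longrightarrow> d f \<in> carrier P"
    and "\<lbrakk>f \<in> carrier P; g \<in> carrier P\<rbrakk> \<Longrightarrow> d (f \<oplus> g) = d f \<oplus> d g"
    and "f \<in> carrier P \<Longrightarrow> d (\<ominus> f) = \<ominus> d f"
    and "d \<zero> = \<zero>"
    by simp_all
  show "d \<one> = \<zero>" "\<lbrakk>j \<in> {1..n}; f \<in> carrier P\<rbrakk> \<Longrightarrow>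
      d (x j \<otimes> f) = (if j \<in> T then f else \<zero>) \<oplus> \<ominus> (x (\<pi> j) \<otimes> d f)"
    "j \<in> {1..n} \<Longrightarrow> \<pi> j \<in> {1..n}"
    using assms unfolding is_odd_derivation_def a_minus_def by blast+
qed

text \<open>Moving \<open>x\<^sub>j\<close> through \<open>d d\<close> leaves \<open>([j \<in> T] - [\<pi> j \<in> T]) d f\<close>.\<close>

lemma odd_derivation_square:
  assumes d: "is_odd_derivation \<pi> T d"
    and inv: "\<And>j. j \<in> {1..n} \<Longrightarrow> \<pi> j \<in> T \<longleftrightarrow> j \<in> T"
    and f: "f \<in> carrier P"
  shows "d (d f) = \<zero>"
proof -
  note [simp] = is_odd_derivation_simps[OF d] inv
  note [simp del] = atLeastAtMost_iff One_nat_def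
  show ?thesis
    using f by (induction f rule: pol_induct) (simp_all add: a_minus_def ring_simprules)
qed

text \<open>Moving \<open>x\<^sub>j\<close> through \<open>d e + e d\<close> leaves
  \<open>([j \<in> T'] - [\<pi> j \<in> T']) d f + ([j \<in> T] - [\<pi>' j \<in> T]) e f\<close>, and the surviving terms match
  since the permutations commute.\<close>

lemma odd_derivations_anticommute:
  assumes d: "is_odd_derivation \<pi> T d" and e: "is_odd_derivation \<pi>' T' e"
    and comm: "\<And>j. j \<in> {1..n} \<Longrightarrow> \<pi> (\<pi>' j) = \<pi>' (\<pi> j)"
    and inv: "\<And>j. j \<in> {1..n} \<Longrightarrow> \<pi> j \<in> T' \<longleftrightarrow> j \<in> T'"
      "\<And>j. j \<in> {1..n} \<Longrightarrow> \<pi>' j \<in> T \<longleftrightarrow> j \<in> T"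
    and f: "f \<in> carrier P"
  shows "d (e f) = \<ominus> e (d f)"
proof -
  note [simp] = is_odd_derivation_simps[OF d] is_odd_derivation_simps[OF e] inv comm
  note [simp del] = atLeastAtMost_iff One_nat_def
  show ?thesis
    using f by (induction f rule: pol_induct) (simp_all add: a_minus_def ring_simprules)
qed

text \<open>Moving \<open>x\<^sub>j\<close> through \<open>d e d\<close> and through \<open>e d e\<close> leaves the same remainder on both sides:
  \<open>d e\<close> for \<open>j = a\<close>, the sum \<open>d e + e d\<close> for \<open>j = b\<close>, and \<open>e d\<close> for \<open>j = c\<close>. Remainders such as
  \<open>d d\<close> vanish.\<close>

lemma odd_derivations_braid:
  assumes d: "is_odd_derivation (Transposition.transpose a b) {a, b} d"
    and e: "is_odd_derivation (Transposition.transpose b c) {b, c} e"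
    and abc: "a \<noteq> b" "b \<noteq> c" "a \<noteq> c" "{a, b, c} \<subseteq> {1..n}"
    and f: "f \<in> carrier P"
  shows "d (e (d f)) = e (d (e f))"
proof -
  note [simp] = is_odd_derivation_simps(1-6)[OF d] is_odd_derivation_simps(1-6)[OF e] abc abc(1-3)[THEN not_sym]
    odd_derivation_square[OF d] odd_derivation_square[OF e]
  note [simp del] = atLeastAtMost_iff One_nat_def
  have [simp]: "a \<in> {1..n}" "b \<in> {1..n}" "c \<in> {1..n}"
    using abc by auto
  show ?thesis
    using f
  proof (induction f rule: pol_induct)
    case (x j f)
    then consider "j = a" | "j = b" | "j = c" | "j \<notin> {a, b, c}"
      by blast
    then show ?case
      using x abc by cases (simp_all add: Transposition.transpose_def a_minus_def ring_simprules)
  qed (simp_all add: a_minus_def ring_simprules)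
qed

text \<open>The sign is forced: for \<open>j = a\<close> the word \<open>e d e d\<close> leaves \<open>e d e\<close> and \<open>d e d e\<close> leaves
  \<open>- e d e\<close>, while for \<open>j = b\<close> the remainders are \<open>e d e - d e d\<close> and its negative.\<close>

lemma odd_derivations_type_B_braid:
  assumes d: "is_odd_derivation (Transposition.transpose a b) {a, b} d"
    and e: "is_odd_derivation id {b} e"
    and ab: "a \<noteq> b" "{a, b} \<subseteq> {1..n}"
    and f: "f \<in> carrier P"
  shows "e (d (e (d f))) = \<ominus> d (e (d (e f)))"
proof -
  note [simp] = is_odd_derivation_simps(1-6)[OF d] is_odd_derivation_simps(1-6)[OF e] ab ab(1)[THEN not_sym]
    odd_derivation_square[OF d] odd_derivation_square[OF e]
  note [simp del] = atLeastAtMost_iff One_nat_def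
  have [simp]: "a \<in> {1..n}" "b \<in> {1..n}"
    using ab by auto
  show ?thesis
    using f
  proof (induction f rule: pol_induct)
    case (x j f)
    then consider "j = a" | "j = b" | "j \<notin> {a, b}"
      by blast
    then show ?case
      using x ab by cases (simp_all add: Transposition.transpose_def a_minus_def ring_simprules)
  qed (simp_all add: a_minus_def ring_simprules)
qed

end

section \<open>The representation\<close>

lemma free_alg_action_one:
  assumes "h \<in> ring_hom (free_alg S) (End_ring M)" "f \<in> carrier M"
  shows "h 1 f = f"
  using ring_hom_one[OF assms(1)] assms(2) by (simp add: free_alg_def End_ring_def)

lemma free_alg_action:
  fixes M (structure)
  assumes "ring M" "h \<in> ring_hom (free_alg S) (End_ring M)"
    and "p \<in> carrier (free_alg S)" "q \<in> carrier (free_alg S)" "f \<in> carrier M"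
  shows "h (p + q) f = h p f \<oplus> h q f" "h (p * q) f = h p (h q f)"
    "h (- p) f = \<ominus> h p f" "h (p - q) f = h p f \<ominus> h q f"
proof -
  interpret ring M by fact
  interpret E: ring "End_ring M" by (rule End_ring_ring[OF assms(1)])
  note hom = free_alg_hom[OF assms(2) E.ring_axioms]
  have E: "u f \<in> carrier M" "(u \<oplus>\<^bsub>End_ring M\<^esub> v) f = u f \<oplus> v f"
    if "u \<in> carrier (End_ring M)" for u v
    using that assms(5) by (auto simp: End_ring_def hom_def)
  have hp: "h r \<in> carrier (End_ring M)" if "r \<in> carrier (free_alg S)" for r
    using assms(2) that by (rule ring_hom_closed)

  show "h (p + q) f = h p f \<oplus> h q f"
    using hom(1) E(2) hp assms(3,4) by simp
  show "h (p * q) f = h p (h q f)"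
    using hom(2) assms(3-5) by (simp add: End_ring_def compose_def)

  have uminus: "h (- r) f = \<ominus> h r f" if r: "r \<in> carrier (free_alg S)" for r
  proof -
    have "h (- r) \<oplus>\<^bsub>End_ring M\<^esub> h r = \<zero>\<^bsub>End_ring M\<^esub>"
      using hom(3)[OF r r] hp[OF r] by (simp add: E.l_neg)
    then have "h (- r) f \<oplus> h r f = \<zero>"
      using E(2)[OF hp[OF uminus_in_free_alg[OF r]], of "h r"] assms(5) by (simp add: End_ring_def)
    then show ?thesis
      using E(1)[OF hp[OF r]] E(1)[OF hp[OF uminus_in_free_alg[OF r]]]
      by (intro minus_equality[symmetric])
  qed
  show "h (- p) f = \<ominus> h p f"
    using assms(3) by (rule uminus)
  show "h (p - q) f = h p f \<ominus> h q f"
    using hom(1)[OF assms(3) uminus_in_free_alg[OF assms(4)]] uminus[OF assms(4)]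
      E(2)[OF hp[OF assms(3)]]
    by (simp add: a_minus_def diff_conv_add_uminus del: add_uminus_conv_diff)
qed

lemma left_mult_in_End_ring:
  assumes "ring M" "a \<in> carrier M"
  shows "left_mult M a \<in> carrier (End_ring M)"
proof -
  interpret ring M by fact
  show ?thesis
    using assms(2) by (auto simp: End_ring_def left_mult_def hom_def r_distr)
qed

context skew_polynomials
begin

lemma is_odd_derivation_demazure:
  assumes i: "i \<in> {1..<n}"
  shows "is_odd_derivation (Transposition.transpose i (i + 1)) {i, i + 1} (demazure n i)"
proof -
  let ?\<pi> = "Transposition.transpose i (i + 1)"
  have "s (x i) = \<ominus> x (i + 1) \<and> s (x (i + 1)) = \<ominus> x i \<and>
      (\<forall>j\<in>{1..n}. j \<noteq> i \<and> j \<noteq> i + 1 \<longrightarrow> s (x j) = \<ominus> x j)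
    \<longleftrightarrow> (\<forall>j\<in>{1..n}. s (x j) = \<ominus> x (?\<pi> j))" for s
    using i by (auto simp: Transposition.transpose_def)
  then have "s_op n i = odd_twist ?\<pi>"
    unfolding s_op_def odd_twist_def P_eq[symmetric] by simp
  then have "demazure n i = odd_derivation ?\<pi> {i, i + 1}"
    unfolding demazure_def odd_derivation_def P_eq[symmetric] by simp
  moreover have "is_odd_derivation ?\<pi> {i, i + 1} (odd_derivation ?\<pi> {i, i + 1})"
    by (rule odd_derivation) (use i in \<open>auto simp: Transposition.transpose_def inj_on_def\<close>)
  ultimately show ?thesis by simp
qed

lemma is_odd_derivation_demazureB: "is_odd_derivation id {n} (demazureB n)"
proof -
  have "sB_op n = odd_twist id"
    unfolding sB_op_def odd_twist_def P_eq[symmetric] by simp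
  then have "demazureB n = odd_derivation id {n}"
    unfolding demazureB_def odd_derivation_def P_eq[symmetric] by simp
  moreover have "is_odd_derivation id {n} (odd_derivation id {n})"
    by (rule odd_derivation) auto
  ultimately show ?thesis by simp
qed

definition nh_action :: "nh_gen \<Rightarrow> (nat fmon \<Rightarrow>\<^sub>0 int) set \<Rightarrow> (nat fmon \<Rightarrow>\<^sub>0 int) set" where
  "nh_action g = (case g of X i \<Rightarrow> left_mult P (x i) | D i \<Rightarrow> demazure n i | DB \<Rightarrow> demazureB n)"

lemma nh_action_closed: "nh_action \<in> nh_gens n \<rightarrow> carrier (End_ring P)"
proof
  fix g assume "g \<in> nh_gens n"
  then show "nh_action g \<in> carrier (End_ring P)"
    using left_mult_in_End_ring[OF ring_axioms x_closed] is_odd_derivation_demazure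
      is_odd_derivation_demazureB
    by (auto simp: nh_gens_def nh_action_def is_odd_derivation_def)
qed

text \<open>The relations between some \<open>x\<^sub>j\<close> and one operator are instances of the commutation rule;
  the others are the relations between odd derivations, for the permutations at hand.\<close>

lemma nh_action_relation:
  assumes n: "n \<ge> 1" and h: "h \<in> ring_hom (free_alg (nh_gens n)) (End_ring P)"
    and gens: "\<And>g. g \<in> nh_gens n \<Longrightarrow> h (gen g) = nh_action g"
    and r: "r \<in> nh_rels n"
  shows "h r = \<zero>\<^bsub>End_ring P\<^esub>"
proof -
  let ?F = "carrier (free_alg (nh_gens n))"
  \<comment> \<open>Membership in \<open>{1..n}\<close> is passed around as a fact and must not be unfolded or rewritten.\<close>
  note [simp del] = One_nat_def atLeastAtMost_iff
  note [simp] = free_alg_action[OF ring_axioms h] free_alg_action_one[OF h]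
  note [simp] = free_alg_closed uminus_in_free_alg one_in_free_alg
  note d = is_odd_derivation_demazure and dB = is_odd_derivation_demazureB
  have n_in [simp]: "n \<in> {1..n}" using n by (simp add: atLeastAtMost_iff)
  have X_in [simp]: "gen (X j) \<in> ?F" if "j \<in> {1..n}" for j
    using that by (intro gen_in_free_alg) (simp add: nh_gens_def)
  have D_in [simp]: "gen (D j) \<in> ?F" if "j \<in> {1..<n}" for j
    using that by (intro gen_in_free_alg) (simp add: nh_gens_def)
  have DB_in [simp]: "gen DB \<in> ?F"
    by (intro gen_in_free_alg) (simp add: nh_gens_def)
  have X [simp]: "h (gen (X j)) f = x j \<otimes> f" if "j \<in> {1..n}" "f \<in> carrier P" for j f
    using gens[of "X j"] that by (simp add: nh_gens_def nh_action_def left_mult_def)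
  have D [simp]: "h (gen (D j)) = demazure n j" if "j \<in> {1..<n}" for j
    using gens[of "D j"] that by (simp add: nh_gens_def nh_action_def)
  have DB [simp]: "h (gen DB) = demazureB n"
    using gens[of DB] by (simp add: nh_gens_def nh_action_def)
  have I: "j \<in> {1..n}" "j + 1 \<in> {1..n}" "j \<noteq> n" if "j \<in> {1..<n}" for j
    using that by (auto simp: atLeastAtMost_iff)
  note [simp] = is_odd_derivation_simps(1-6)[OF d] is_odd_derivation_simps(1-6)[OF dB]
  have zero: "h r f = \<zero>" if f [simp]: "f \<in> carrier P" for f
    using r
  proof cases
    case (X_X i j)
    then show ?thesis
      using x_anticommute[of i j] by (simp add: m_assoc[symmetric] l_distr[symmetric])
  next
    case (D_sq i)
    then show ?thesis
      using odd_derivation_square[OF d[of i] _ f]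
      by (simp add: I) (auto simp: Transposition.transpose_def)
  next
    case (D_braid i)
    then show ?thesis
      using odd_derivations_braid[OF d[of i] d[of "i + 1", simplified] _ _ _ _ f] I[of i] I[of "i + 1"]
      by (simp add: a_minus_def r_neg)
  next
    case (D_D i j)
    then have "demazure n i (demazure n j f) = \<ominus> demazure n j (demazure n i f)"
      by (intro odd_derivations_anticommute[OF d d _ _ _ f])
        (auto simp: Transposition.transpose_def)
    with D_D show ?thesis by (simp add: l_neg)
  next
    case (X_D i)
    then show ?thesis by (simp add: I Transposition.transpose_def ring_simprules)
  next
    case (D_X i)
    then show ?thesis by (simp add: I Transposition.transpose_def ring_simprules)
  next
    case (D_X_far i j)
    then show ?thesis by (simp add: I Transposition.transpose_def ring_simprules)
  next
    case DB_sq
    then show ?thesis using odd_derivation_square[OF dB _ f] by simp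
  next
    case DB_braid
    then have i: "n - 1 \<in> {1..<n}" "n - 1 + 1 = n" by auto
    from i have "demazureB n (demazure n (n - 1) (demazureB n (demazure n (n - 1) f)))
      = \<ominus> demazure n (n - 1) (demazureB n (demazure n (n - 1) (demazureB n f)))"
      using DB_braid I[OF i(1)]
      by (intro odd_derivations_type_B_braid[OF d[OF i(1), unfolded i(2)] dB _ _ f]) auto
    then show ?thesis using DB_braid i by (simp add: ring_simprules)
  next
    case (DB_D i)
    then have i: "i \<in> {1..<n}" by auto
    from i have "demazureB n (demazure n i f) = \<ominus> demazure n i (demazureB n f)"
      using DB_D
      by (intro odd_derivations_anticommute[OF dB d _ _ _ f])
        (auto simp: Transposition.transpose_def)
    with i DB_D show ?thesis by (simp add: l_neg)
  next
    case DB_X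
    then show ?thesis by (simp add: ring_simprules)
  next
    case (DB_X_far i)
    then show ?thesis by (simp add: I ring_simprules)
  qed
  have "r \<in> ?F"
    using nh_rels_carrier[OF n] r by blast
  then have "h r \<in> extensional (carrier P)"
    using ring_hom_closed[OF h] by (auto simp: End_ring_def)
  then show ?thesis
    using zero by (intro extensionalityI[of _ "carrier P"]) (auto simp: End_ring_def)
qed

end

theorem theorem2p7:
  fixes n :: nat
  assumes "n \<ge> 1"
  shows "\<exists>\<rho> \<in> ring_hom (NH_B n) (End_ring (Pol n)).
           (\<forall>i\<in>{1..n}. \<rho> (nh_x n i) = left_mult (Pol n) (pol_x n i)) \<and>
           (\<forall>i\<in>{1..<n}. \<rho> (nh_d n i) = demazure n i) \<and>
           \<rho> (nh_dB n) = demazureB n"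
proof -
  interpret skew_polynomials n "Pol n"
    by standard simp
  have "\<exists>\<rho>\<in>ring_hom (NH_B n) (End_ring (Pol n)).
      \<forall>g\<in>nh_gens n. \<rho> (presented_gen (nh_gens n) (nh_rels n) g) = nh_action g"
    unfolding NH_B_def
    by (rule presented_hom_exists[OF End_ring_ring[OF Pol_ring] nh_rels_carrier[OF assms]
        nh_action_closed]) (rule nh_action_relation[OF assms])
  then obtain \<rho> where \<rho>: "\<rho> \<in> ring_hom (NH_B n) (End_ring (Pol n))"
    "\<And>g. g \<in> nh_gens n \<Longrightarrow> \<rho> (presented_gen (nh_gens n) (nh_rels n) g) = nh_action g"
    by blast
  show ?thesis
    using \<rho> by (intro bexI[of _ \<rho>])
      (auto simp: nh_x_def nh_d_def nh_dB_def nh_gens_def nh_action_def)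
qed

end
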